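(* Let $k \geq 3$ be an integer. For every integer $t \geq 2$, \[ \textup{ex}_{\chi \leq k}(n, K_{2,t}) \leq \left(\left(1 - \frac{1}{k}\right)^{1/2} + o(1)\right)\frac{\sqrt{t-1}}{2}\, n^{3/2}. \] Also, \[ \textup{ex}_{\chi \leq k}(n, K_{3,3}) \leq \left(\left(1 - \frac{1}{k}\right)^{2/3} + o(1)\right)\frac{n^{5/3}}{2}. \] Here $o(1)$ denotes a quantity tending to $0$ as $n \to \infty$ (with $k$ and $t$ fixed).
   Context: For a graph $F$ and an integer $k \geq 2$, $\textup{ex}_{\chi \leq k}(n,F)$ denotes the maximum number of edges in an $n$-vertex graph $G$ that has no subgraph isomorphic to $F$ and has chromatic number at most $k$ (equivalently, $G$ is $k$-partite). $K_{s,t}$ is the complete bipartite graph with parts of sizes $s$ and $t$. *)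

theory Defs
  imports Complex_Main
begin

type_synonym 'a graph = "'a set \<times> 'a set set"

abbreviation verts :: "'a graph \<Rightarrow> 'a set" where "verts G \<equiv> fst G"

abbreviation edges :: "'a graph \<Rightarrow> 'a set set" where "edges G \<equiv> snd G"

definition simple_graph :: "'a graph \<Rightarrow> bool" where
  "simple_graph G \<longleftrightarrow> finite (verts G) \<and> (\<forall>e\<in>edges G. e \<subseteq> verts G \<and> card e = 2)"

definition subgraph :: "'a graph \<Rightarrow> 'a graph \<Rightarrow> bool" where
  "subgraph H G \<longleftrightarrow> simple_graph H \<and> verts H \<subseteq> verts G \<and> edges H \<subseteq> edges G"

definition graph_isomorphic :: "'a graph \<Rightarrow> 'b graph \<Rightarrow> bool" where
  "graph_isomorphic G H \<longleftrightarrow>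
     (\<exists>f. bij_betw f (verts G) (verts H) \<and>
          (\<forall>u\<in>verts G. \<forall>v\<in>verts G. {u, v} \<in> edges G \<longleftrightarrow> {f u, f v} \<in> edges H))"

definition graph_free :: "'b graph \<Rightarrow> 'a graph \<Rightarrow> bool" where
  "graph_free F G \<longleftrightarrow> \<not> (\<exists>H. subgraph H G \<and> graph_isomorphic H F)"

definition colourable :: "'a graph \<Rightarrow> nat \<Rightarrow> bool" where
  "colourable G k \<longleftrightarrow>
     (\<exists>c :: 'a \<Rightarrow> nat. c ` verts G \<subseteq> {..<k} \<and> (\<forall>u v. {u, v} \<in> edges G \<longrightarrow> c u \<noteq> c v))"

definition chromatic_number :: "'a graph \<Rightarrow> nat" where
  "chromatic_number G = (LEAST k. colourable G k)"

definition complete_bipartite :: "nat \<Rightarrow> nat \<Rightarrow> (nat + nat) graph" where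
  "complete_bipartite s t =
     ({..<s} <+> {..<t}, {{Inl i, Inr j} | i j. i < s \<and> j < t})"

definition chi_free_graphs :: "nat \<Rightarrow> nat \<Rightarrow> 'b graph \<Rightarrow> nat graph set" where
  "chi_free_graphs k n F =
     {G. simple_graph G \<and> card (verts G) = n \<and> graph_free F G \<and> chromatic_number G \<le> k}"

text \<open>Every finite graph is isomorphic to one whose vertices are natural numbers, so
  restricting the vertex type to \<^typ>\<open>nat\<close> loses no edge counts.
  \<^const>\<open>Max\<close> is unspecified on empty or infinite sets; see \<open>ex_chi_attained\<close> below.\<close>

definition ex_chi :: "nat \<Rightarrow> nat \<Rightarrow> 'b graph \<Rightarrow> nat" where
  "ex_chi k n F = Max ((\<lambda>G. card (edges G)) ` chi_free_graphs k n F)"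

lemma colourable_card:
  assumes "simple_graph G"
  shows "colourable G (card (verts G))"
proof -
  have "finite (verts G)" using assms by (simp add: simple_graph_def)
  then obtain c where c: "bij_betw c (verts G) {0..<card (verts G)}"
    using ex_bij_betw_finite_nat by blast
  have "c u \<noteq> c v" if "{u, v} \<in> edges G" for u v
  proof -
    have "u \<in> verts G" "v \<in> verts G" "card {u, v} = 2"
      using that assms by (auto simp: simple_graph_def)
    then show ?thesis using c by (auto simp: bij_betw_def inj_on_def)
  qed
  moreover have "c ` verts G \<subseteq> {..<card (verts G)}"
    using c by (auto simp: bij_betw_def)
  ultimately show ?thesis unfolding colourable_def by blast
qed

lemma chromatic_number_le_iff:
  assumes "simple_graph G"
  shows "chromatic_number G \<le> k \<longleftrightarrow> colourable G k"
proof
  assume k: "chromatic_number G \<le> k"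
  have "colourable G (chromatic_number G)"
    unfolding chromatic_number_def using colourable_card[OF assms] by (rule LeastI)
  then obtain c :: "'a \<Rightarrow> nat" where "c ` verts G \<subseteq> {..<chromatic_number G}"
    and c: "\<forall>u v. {u, v} \<in> edges G \<longrightarrow> c u \<noteq> c v"
    unfolding colourable_def by blast
  with k have "c ` verts G \<subseteq> {..<k}" by (meson lessThan_subset_iff subset_trans)
  with c show "colourable G k" unfolding colourable_def by blast
next
  assume "colourable G k"
  then show "chromatic_number G \<le> k"
    unfolding chromatic_number_def by (rule Least_le)
qed

lemma finite_edge_counts: "finite ((\<lambda>G. card (edges G)) ` chi_free_graphs k n F)"
proof (rule finite_subset)
  show "(\<lambda>G. card (edges G)) ` chi_free_graphs k n F \<subseteq> {..2 ^ n}"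
  proof clarsimp
    fix V :: "nat set" and E
    assume "(V, E) \<in> chi_free_graphs k n F"
    then have "finite V" "card V = n" "E \<subseteq> Pow V"
      by (auto simp: chi_free_graphs_def simple_graph_def)
    then show "card E \<le> 2 ^ n"
      using card_mono[of "Pow V" E] by (simp add: card_Pow)
  qed
qed simp

lemma chi_free_graphs_nonempty:
  assumes "1 \<le> k" "1 \<le> s" "1 \<le> t"
  shows "chi_free_graphs k n (complete_bipartite s t) \<noteq> {}"
proof -
  let ?G = "({..<n}, {}) :: nat graph"
  have s: "simple_graph ?G" by (simp add: simple_graph_def)
  have "colourable ?G k"
    using assms by (auto simp: colourable_def intro!: exI[of _ "\<lambda>_. 0"])
  moreover have "graph_free (complete_bipartite s t) ?G"
    unfolding graph_free_def
  proof clarify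
    fix V :: "nat set" and E
    assume "subgraph (V, E) ?G" and "graph_isomorphic (V, E) (complete_bipartite s t)"
    then obtain f where f: "bij_betw f V ({..<s} <+> {..<t})"
      and E: "\<And>u v. u \<in> V \<Longrightarrow> v \<in> V \<Longrightarrow> {f u, f v} \<notin> edges (complete_bipartite s t)"
      by (auto simp: subgraph_def graph_isomorphic_def complete_bipartite_def)
    have "f ` V = {..<s} <+> {..<t}" using f by (simp add: bij_betw_def)
    moreover have "Inl 0 \<in> {..<s} <+> {..<t}" "Inr 0 \<in> {..<s} <+> {..<t}"
      using assms by auto
    ultimately obtain u v where uv: "u \<in> V" "v \<in> V" "Inl 0 = f u" "Inr 0 = f v"
      by (metis imageE)
    have "\<exists>i j. {f u, f v} = {Inl i, Inr j} \<and> i < s \<and> j < t"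
      using assms uv(3,4)[symmetric] by (intro exI[of _ 0]) simp
    then have "{f u, f v} \<in> edges (complete_bipartite s t)"
      by (simp add: complete_bipartite_def)
    with E[OF uv(1,2)] show False by contradiction
  qed
  ultimately have "?G \<in> chi_free_graphs k n (complete_bipartite s t)"
    using s chromatic_number_le_iff[OF s] by (simp add: chi_free_graphs_def)
  then show ?thesis by blast
qed

lemma ex_chi_attained:
  assumes "1 \<le> k" "1 \<le> s" "1 \<le> t"
  shows "\<exists>G\<in>chi_free_graphs k n (complete_bipartite s t).
           card (edges G) = ex_chi k n (complete_bipartite s t)"
proof -
  have "ex_chi k n (complete_bipartite s t)
      \<in> (\<lambda>G. card (edges G)) ` chi_free_graphs k n (complete_bipartite s t)"
    unfolding ex_chi_def
    using chi_free_graphs_nonempty[OF assms] by (intro Max_in finite_edge_counts) simp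
  then show ?thesis by force
qed

end

theory Submission
  imports Defs "HOL-Analysis.Convex" "HOL-Real_Asymp.Real_Asymp"
begin

text \<open>Split the degree sum \<open>2 e(G)\<close> over the colour classes \<open>A\<close> of sizes \<open>a\<close>. The edges at \<open>A\<close> form
  a bipartite graph between \<open>A\<close> and its complement, of size \<open>n - a\<close>, so Zarankiewicz bounds give
  at most \<open>C a (n - a)\<^sup>p\<close> of them up to lower order terms, where \<open>p = 1/2\<close>, \<open>C = \<surd>(t - 1)\<close> for
  \<open>K\<^bsub>2,t\<^esub>\<close> (Kovari, Sos, Turan) and \<open>p = 2/3\<close>, \<open>C = 1\<close> for \<open>K\<^bsub>3,3\<^esub>\<close> (Fueredi).
  As \<open>x \<mapsto> x\<^sup>p\<close> is concave and \<open>\<Sum>a (n - a) \<le> (1 - 1/k) n\<^sup>2\<close>, the sum over the at most \<open>k\<close>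
  classes is at most \<open>C (1 - 1/k)\<^sup>p n\<^bsup>1+p\<^esup>\<close>.\<close>

section \<open>Zarankiewicz bounds\<close>

text \<open>Both sides count the pairs \<open>(b, S)\<close> in which \<open>S\<close> is an
  \<open>s\<close>-element subset of \<open>N b\<close>.\<close>

lemma sum_choose_card:
  assumes "finite A" "finite B" "\<And>b. b \<in> B \<Longrightarrow> N b \<subseteq> A"
  shows "(\<Sum>b\<in>B. card (N b) choose s) = (\<Sum>S | S \<subseteq> A \<and> card S = s. card {b\<in>B. S \<subseteq> N b})"
proof -
  have "card (N b) choose s = card {S \<in> {S. S \<subseteq> A \<and> card S = s}. S \<subseteq> N b}" if "b \<in> B" for b
  proof -
    have "{S \<in> {S. S \<subseteq> A \<and> card S = s}. S \<subseteq> N b} = {S. S \<subseteq> N b \<and> card S = s}"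
      using assms(3)[OF that] by auto
    with n_subsets[of "N b" s] show ?thesis
      using assms(1) assms(3)[OF that] by (simp add: finite_subset)
  qed
  then have "(\<Sum>b\<in>B. card (N b) choose s)
      = (\<Sum>b\<in>B. card {S \<in> {S. S \<subseteq> A \<and> card S = s}. S \<subseteq> N b})"
    by (rule sum.cong[OF refl])
  also have "\<dots> = (\<Sum>S | S \<subseteq> A \<and> card S = s. card {b\<in>B. S \<subseteq> N b})"
    using assms(1,2) by (intro sum_multicount_gen) auto
  finally show ?thesis .
qed

text \<open>The counting step shared by both Zarankiewicz bounds: it is used with pairs from the
  whole side \<open>A\<close> in \<open>zarankiewicz_two\<close>, and with triples inside one fixed
  \<open>N b\<close> in \<open>zarankiewicz_three\<close>.\<close>

lemma sum_choose_card_le: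
  assumes "finite A" "finite B" "\<And>b. b \<in> B \<Longrightarrow> N b \<subseteq> A"
    and "\<And>S. S \<subseteq> A \<Longrightarrow> card S = s \<Longrightarrow> card {b\<in>B. S \<subseteq> N b} \<le> r"
  shows "(\<Sum>b\<in>B. card (N b) choose s) \<le> r * (card A choose s)"
proof -
  have "(\<Sum>b\<in>B. card (N b) choose s) = (\<Sum>S | S \<subseteq> A \<and> card S = s. card {b\<in>B. S \<subseteq> N b})"
    by (rule sum_choose_card) (use assms in auto)
  also have "\<dots> \<le> (\<Sum>S | S \<subseteq> A \<and> card S = s. r)"
    by (intro sum_mono) (use assms(4) in auto)
  finally show ?thesis by (simp add: n_subsets[OF assms(1)] mult.commute)
qed

lemma real_choose_two: "2 * real (n choose 2) = real n ^ 2 - real n"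
  by (induction n) (auto simp: numeral_2_eq_2 algebra_simps)

text \<open>The right side is n(n-1)(n-2), each factor of which is at least n-2. Truncated
  subtraction makes the left side 0 for n below 2.\<close>

lemma cube_le_six_choose_three: "(n - 2) ^ 3 \<le> 6 * (n choose 3)"
proof (cases "n \<ge> 2")
  case True
  have "6 * ((m + 2) choose 3) = m * (m + 1) * (m + 2)" for m
  proof (induction m)
    case (Suc m)
    have "2 * ((m + 2) choose 2) = (m + 2) * (m + 1)"
      by (simp add: choose_two)
    with Suc show ?case by (simp add: numeral_3_eq_3 numeral_2_eq_2 algebra_simps)
  qed (simp add: numeral_3_eq_3 numeral_2_eq_2)
  moreover obtain m where "n = m + 2" using True le_Suc_ex by (metis add.commute)
  ultimately show ?thesis by (simp add: power3_eq_cube algebra_simps)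
qed simp

text \<open>The power mean inequality for exponent 3, obtained by summing the tangent line of the
  cube at the mean \<open>\<mu>\<close>.\<close>

lemma sum_cubed_le_sum_of_cubes:
  fixes f :: "'a \<Rightarrow> real"
  assumes "\<And>i. i \<in> I \<Longrightarrow> 0 \<le> f i"
  shows "(\<Sum>i\<in>I. f i) ^ 3 \<le> real (card I) ^ 2 * (\<Sum>i\<in>I. f i ^ 3)"
proof (cases "finite I \<and> I \<noteq> {}")
  case True
  define m S \<mu> where "m = real (card I)" and "S = (\<Sum>i\<in>I. f i)" and "\<mu> = S / m"
  have m: "m > 0" using True by (auto simp: m_def card_gt_0_iff)
  have \<mu>: "\<mu> \<ge> 0" using m assms by (auto simp: \<mu>_def S_def intro: sum_nonneg divide_nonneg_pos)
  \<comment> \<open>The gap between the cube and its tangent at \<open>\<mu>\<close> factors as (x -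
    \<mu>)^2 (x + 2\<mu>), which is nonnegative for x \<ge> 0.\<close>
  have "3 * \<mu>^2 * f i - 2 * \<mu>^3 \<le> f i ^ 3" if "i \<in> I" for i
  proof -
    have "0 \<le> (f i - \<mu>)^2 * (f i + 2 * \<mu>)" using \<mu> assms[OF that] by simp
    then show ?thesis by (simp add: power2_eq_square power3_eq_cube algebra_simps)
  qed
  then have "(\<Sum>i\<in>I. 3 * \<mu>^2 * f i - 2 * \<mu>^3) \<le> (\<Sum>i\<in>I. f i ^ 3)" by (rule sum_mono)
  then have "3 * \<mu>^2 * S - 2 * m * \<mu>^3 \<le> (\<Sum>i\<in>I. f i ^ 3)"
    by (simp add: sum_subtractf sum_distrib_left sum_distrib_right S_def m_def algebra_simps)
  moreover have "3 * \<mu>^2 * S - 2 * m * \<mu>^3 = S ^ 3 / m ^ 2"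
    using m by (simp add: \<mu>_def power2_eq_square power3_eq_cube field_simps)
  ultimately have "S ^ 3 / m ^ 2 \<le> (\<Sum>i\<in>I. f i ^ 3)" by simp
  then have "S ^ 3 \<le> m ^ 2 * (\<Sum>i\<in>I. f i ^ 3)"
    using m by (simp add: pos_divide_le_eq mult.commute)
  then show ?thesis by (simp add: S_def m_def)
qed auto

section \<open>The Kovari-Sos-Turan bound for pairs\<close>

text \<open>Counting pairs bounds the sum of squared degrees on the side \<open>B\<close> by
  \<open>r * a ^ 2 + e\<close>; Cauchy-Schwarz then gives a quadratic inequality for the edge count
  \<open>e\<close>.\<close>

lemma zarankiewicz_two:
  assumes "finite A" "finite B" "\<And>b. b \<in> B \<Longrightarrow> N b \<subseteq> A"
    and "\<And>S. S \<subseteq> A \<Longrightarrow> card S = 2 \<Longrightarrow> card {b\<in>B. S \<subseteq> N b} \<le> r"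
  shows "real (\<Sum>b\<in>B. card (N b)) \<le> real (card B) + sqrt r * card A * sqrt (card B)"
proof -
  define a m e where "a = real (card A)" and "m = real (card B)" and "e = (\<Sum>b\<in>B. real (card (N b)))"
  have am: "a \<ge> 0" "m \<ge> 0" by (auto simp: a_def m_def)
  have "(\<Sum>b\<in>B. card (N b) choose 2) \<le> r * (card A choose 2)"
    by (rule sum_choose_card_le) (use assms in auto)
  then have "2 * real (\<Sum>b\<in>B. card (N b) choose 2) \<le> 2 * real (r * (card A choose 2))"
    by (simp only: of_nat_le_iff mult_le_cancel_left_pos zero_less_numeral)
  then have "(\<Sum>b\<in>B. 2 * real (card (N b) choose 2)) \<le> r * (2 * real (card A choose 2))"
    by (simp add: sum_distrib_left)
  then have "(\<Sum>b\<in>B. real (card (N b)) ^ 2) - e \<le> r * (a ^ 2 - a)"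
    unfolding real_choose_two by (simp add: sum_subtractf e_def a_def)
  also have "\<dots> \<le> r * a ^ 2" using am by (intro mult_left_mono) auto
  finally have "(\<Sum>b\<in>B. real (card (N b)) ^ 2) \<le> r * a ^ 2 + e" by simp
  then have "(\<Sum>b\<in>B. real (card (N b)) ^ 2) * m \<le> (r * a ^ 2 + e) * m"
    using am by (intro mult_right_mono)
  moreover have "e ^ 2 \<le> (\<Sum>b\<in>B. real (card (N b)) ^ 2) * m"
    unfolding e_def m_def by (rule sum_squared_le_sum_of_squares)
  ultimately have e: "e ^ 2 \<le> (r * a ^ 2 + e) * m" by simp
  \<comment> \<open>Instead of solving the quadratic: if e \<ge> m then (e - m)^2 \<le> (e - m) e =
    e^2 - e m, and the bound on e^2 leaves only r a^2 m.\<close>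
  have "e - m \<le> sqrt r * a * sqrt m"
  proof (cases "e \<ge> m")
    case True
    have "(e - m) ^ 2 \<le> (e - m) * e"
      using True am by (auto simp: power2_eq_square intro: mult_left_mono)
    also have "\<dots> \<le> r * a ^ 2 * m" using e by (simp add: power2_eq_square algebra_simps)
    also have "\<dots> = (sqrt r * a * sqrt m) ^ 2" using am by (simp add: power_mult_distrib)
    finally show ?thesis by (rule power2_le_imp_le) (use am in simp)
  next
    case False
    moreover have "0 \<le> sqrt r * a * sqrt m" using am by simp
    ultimately show ?thesis by linarith
  qed
  then show ?thesis by (simp add: e_def a_def m_def)
qed

section \<open>Codegrees and the bound for triples\<close>

text \<open>Both sides count the triples \<open>(a, b, b')\<close> with \<open>a\<close> in
  \<open>N b\<close> and in \<open>N b'\<close>, the case \<open>b = b'\<close> included.\<close>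

lemma sum_card_Int:
  assumes "finite A" "finite B" "\<And>b. b \<in> B \<Longrightarrow> N b \<subseteq> A"
  shows "(\<Sum>b\<in>B. \<Sum>b'\<in>B. card (N b \<inter> N b')) = (\<Sum>a\<in>A. (card {b\<in>B. a \<in> N b})\<^sup>2)"
proof -
  have "(\<Sum>b\<in>B. \<Sum>b'\<in>B. card (N b \<inter> N b'))
      = (\<Sum>x\<in>B \<times> B. card {a \<in> A. a \<in> N (fst x) \<inter> N (snd x)})"
    unfolding sum.cartesian_product
    by (intro sum.cong refl) (use assms(3) in \<open>auto intro!: arg_cong[of _ _ card]\<close>)
  also have "\<dots> = (\<Sum>a\<in>A. (card {b\<in>B. a \<in> N b})\<^sup>2)"
  proof (intro sum_multicount_gen ballI)
    fix a
    have "{x \<in> B \<times> B. a \<in> N (fst x) \<inter> N (snd x)} = {b\<in>B. a \<in> N b} \<times> {b\<in>B. a \<in> N b}"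
      by auto
    then show "card {x \<in> B \<times> B. a \<in> N (fst x) \<inter> N (snd x)} = (card {b\<in>B. a \<in> N b})\<^sup>2"
      by (simp add: card_cartesian_product power2_eq_square)
  qed (use assms in auto)
  finally show ?thesis .
qed

text \<open>Fueredi's argument: a triple inside \<open>N b\<close> lies in at most one further \<open>N b'\<close>. Bounding triples
  locally like this, instead of all triples of \<open>A\<close> at once, saves the factor \<open>2\<^bsup>1/3\<^esup>\<close> lost in the
  Kovari--Sos--Turan argument.\<close>

lemma zarankiewicz_three:
  assumes "finite A" "finite B" "\<And>b. b \<in> B \<Longrightarrow> N b \<subseteq> A"
    and "\<And>T. T \<subseteq> A \<Longrightarrow> card T = 3 \<Longrightarrow> card {b\<in>B. T \<subseteq> N b} \<le> 2"
  shows "real (\<Sum>b\<in>B. card (N b))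
      \<le> card A * real (card B) powr (2/3) + card A + 2 * real (card B) powr (4/3)"
proof -
  \<comment> \<open>The exponent 2/3 makes \<open>p ^ 3 = m\<^sup>2\<close>, the factor that the
    power mean inequality for cubes produces.\<close>
  define a m e p where "a = real (card A)" and "m = real (card B)"
    and "e = (\<Sum>b\<in>B. real (card (N b)))" and "p = m powr (2/3)"
  have nonneg: "a \<ge> 0" "m \<ge> 0" "p \<ge> 0" by (auto simp: a_def m_def p_def)
  have p2: "p\<^sup>2 = m powr (4/3)" and p3: "p ^ 3 = m\<^sup>2"
    using nonneg by (cases "m = 0"; simp add: p_def powr_power)+
  \<comment> \<open>The power mean inequality turns the count of triples inside \<open>N b\<close>
    into a bound linear in \<open>card (N b)\<close>. The term \<open>2 * m\<close> pays for the
    shift by 2 in \<open>y\<close>, which makes the cubes comparable with binomial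
    coefficients.\<close>
  have codegree: "(\<Sum>b'\<in>B - {b}. real (card (N b \<inter> N b'))) \<le> p * card (N b) + 2 * m"
    if b: "b \<in> B" for b
  proof -
    define y where "y = (\<lambda>b'. real (card (N b \<inter> N b') - 2))"
    have "card {b' \<in> B - {b}. T \<subseteq> N b \<inter> N b'} \<le> 1" if T: "T \<subseteq> N b" "card T = 3" for T
    proof -
      \<comment> \<open>Of the at most two sets containing \<open>T\<close>, one is
        \<open>N b\<close> itself, so at most one other index remains.\<close>
      have "{b'\<in>B. T \<subseteq> N b'} = insert b {b' \<in> B - {b}. T \<subseteq> N b \<inter> N b'}" using b T by auto
      then have "card {b'\<in>B. T \<subseteq> N b'} = Suc (card {b' \<in> B - {b}. T \<subseteq> N b \<inter> N b'})"
        using assms(2) by simp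
      with assms(4)[of T] T assms(3)[OF b] show ?thesis by auto
    qed
    then have "(\<Sum>b'\<in>B - {b}. card (N b \<inter> N b') choose 3) \<le> 1 * (card (N b) choose 3)"
      using assms(1,2) assms(3)[OF b] by (intro sum_choose_card_le) (auto intro: finite_subset)
    then have "6 * (\<Sum>b'\<in>B - {b}. card (N b \<inter> N b') choose 3) \<le> card (N b) ^ 3"
      using binomial_fact_pow[of "card (N b)" 3] by (simp add: fact_numeral)
    moreover have "(\<Sum>b'\<in>B - {b}. (card (N b \<inter> N b') - 2) ^ 3)
        \<le> 6 * (\<Sum>b'\<in>B - {b}. card (N b \<inter> N b') choose 3)"
      unfolding sum_distrib_left by (intro sum_mono cube_le_six_choose_three)
    ultimately have "(\<Sum>b'\<in>B - {b}. (card (N b \<inter> N b') - 2) ^ 3) \<le> card (N b) ^ 3" by linarith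
    then have y3: "(\<Sum>b'\<in>B - {b}. y b' ^ 3) \<le> real (card (N b)) ^ 3"
      unfolding y_def by (simp flip: of_nat_power of_nat_sum)
    have card: "real (card (B - {b})) \<le> m" using assms(2) by (auto simp: m_def intro: card_mono)
    have "(\<Sum>b'\<in>B - {b}. y b') ^ 3 \<le> real (card (B - {b})) ^ 2 * (\<Sum>b'\<in>B - {b}. y b' ^ 3)"
      by (rule sum_cubed_le_sum_of_cubes) (simp add: y_def)
    also have "\<dots> \<le> m\<^sup>2 * real (card (N b)) ^ 3"
      using card y3 by (intro mult_mono power_mono) (auto simp: y_def intro!: sum_nonneg)
    also have "\<dots> = (p * card (N b)) ^ 3" by (simp add: power_mult_distrib p3)
    finally have "(\<Sum>b'\<in>B - {b}. y b') \<le> p * card (N b)"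
      using nonneg by (subst (asm) power_mono_iff) (auto simp: y_def intro!: sum_nonneg)
    moreover have "(\<Sum>b'\<in>B - {b}. real (card (N b \<inter> N b'))) \<le> (\<Sum>b'\<in>B - {b}. y b' + 2)"
      by (intro sum_mono) (simp add: y_def)
    ultimately show ?thesis using card by (simp add: sum.distrib)
  qed
  \<comment> \<open>Cauchy-Schwarz over the degrees of \<open>A\<close> leads to the total codegree:
    its diagonal terms sum to \<open>e\<close>, and \<open>codegree\<close> bounds the rest.\<close>
  have "e\<^sup>2 \<le> a * (p * e + e + 2 * m\<^sup>2)"
  proof -
    have "e = (\<Sum>a\<in>A. real (card {b\<in>B. a \<in> N b}))"
    proof -
      have "(\<Sum>b\<in>B. card (N b)) = (\<Sum>b\<in>B. card {a\<in>A. a \<in> N b})"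
        using assms(3) by (intro sum.cong refl arg_cong[of _ _ card]) auto
      also have "\<dots> = (\<Sum>a\<in>A. card {b\<in>B. a \<in> N b})"
        using assms(1,2) by (intro sum_multicount_gen) auto
      finally show ?thesis unfolding e_def of_nat_sum[symmetric] by (rule arg_cong)
    qed
    then have "e\<^sup>2 \<le> (\<Sum>a\<in>A. (real (card {b\<in>B. a \<in> N b}))\<^sup>2) * a"
      unfolding a_def by (simp only: sum_squared_le_sum_of_squares)
    also have "(\<Sum>a\<in>A. (real (card {b\<in>B. a \<in> N b}))\<^sup>2) = real (\<Sum>b\<in>B. \<Sum>b'\<in>B. card (N b \<inter> N b'))"
      using sum_card_Int[OF assms(1-3)] by simp
    also have "\<dots> = (\<Sum>b\<in>B. card (N b) + (\<Sum>b'\<in>B - {b}. real (card (N b \<inter> N b'))))"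
      using assms(2) by (simp add: sum.remove)
    also have "\<dots> * a \<le> (\<Sum>b\<in>B. card (N b) + (p * card (N b) + 2 * m)) * a"
      using codegree nonneg by (intro mult_right_mono sum_mono add_left_mono) auto
    also have "(\<Sum>b\<in>B. card (N b) + (p * card (N b) + 2 * m)) = p * e + e + 2 * m\<^sup>2"
      by (simp add: sum.distrib sum_distrib_left e_def m_def power2_eq_square)
    finally show ?thesis by (simp add: mult.commute)
  qed
  \<comment> \<open>If this fails, then in particular e \<ge> a p, so 2 a m^2 = 2 a p^3 \<le> 2 p^2
    e. The quadratic inequality becomes e^2 \<le> (a p + a + 2 p^2) e < e^2.\<close>
  have "e \<le> a * p + a + 2 * p\<^sup>2"
  proof (rule ccontr)
    assume *: "\<not> ?thesis"
    have "0 \<le> a * p" using nonneg by simp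
    moreover have "0 \<le> a + 2 * p\<^sup>2" using nonneg by simp
    ultimately have e: "e > 0" "e \<ge> a * p" using * by linarith+
    have "2 * a * p ^ 3 \<le> 2 * p\<^sup>2 * e"
      using mult_left_mono[OF e(2), of "2 * p\<^sup>2"] by (simp add: power2_eq_square power3_eq_cube mult_ac)
    moreover have "(a * p + a + 2 * p\<^sup>2) * e < e * e" using * e(1) by (intro mult_strict_right_mono) auto
    ultimately show False
      using \<open>e\<^sup>2 \<le> a * (p * e + e + 2 * m\<^sup>2)\<close> unfolding p3[symmetric]
      by (simp add: power2_eq_square algebra_simps)
  qed
  then show ?thesis unfolding p2 by (simp add: e_def a_def p_def m_def)
qed

section \<open>Graphs\<close>

definition neighbours :: "'a graph \<Rightarrow> 'a \<Rightarrow> 'a set" where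
  "neighbours G v = {u. {u, v} \<in> edges G}"

lemma neighbours_subset: "simple_graph G \<Longrightarrow> neighbours G v \<subseteq> verts G"
  by (auto simp: neighbours_def simple_graph_def)

lemma finite_edges: "simple_graph G \<Longrightarrow> finite (edges G)"
  by (rule finite_subset[of _ "Pow (verts G)"]) (auto simp: simple_graph_def)

text \<open>The handshake lemma, by counting incidences between vertices and edges.\<close>

lemma sum_card_neighbours:
  assumes G: "simple_graph G"
  shows "(\<Sum>v\<in>verts G. card (neighbours G v)) = 2 * card (edges G)"
proof -
  have "card (neighbours G v) = card {e\<in>edges G. v \<in> e}" for v
  proof (rule bij_betw_same_card)
    show "bij_betw (\<lambda>u. {u, v}) (neighbours G v) {e\<in>edges G. v \<in> e}"
      unfolding bij_betw_def
    proof
      show "inj_on (\<lambda>u. {u, v}) (neighbours G v)" by (auto simp: inj_on_def doubleton_eq_iff)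
      have "e \<in> (\<lambda>u. {u, v}) ` neighbours G v" if e: "e \<in> edges G" "v \<in> e" for e
      proof -
        have "card e = 2" using e G by (auto simp: simple_graph_def)
        with e(2) obtain u where "e = {u, v}" by (auto simp: card_2_iff)
        with e(1) show ?thesis by (auto simp: neighbours_def)
      qed
      then show "(\<lambda>u. {u, v}) ` neighbours G v = {e\<in>edges G. v \<in> e}"
        by (auto simp: neighbours_def)
    qed
  qed
  then have "(\<Sum>v\<in>verts G. card (neighbours G v)) = (\<Sum>v\<in>verts G. card {e\<in>edges G. v \<in> e})" by simp
  also have "\<dots> = 2 * card (edges G)"
  proof (rule sum_multicount)
    show "\<forall>e\<in>edges G. card {v\<in>verts G. v \<in> e} = 2"
    proof
      fix e assume "e \<in> edges G"
      then have "{v\<in>verts G. v \<in> e} = e" "card e = 2" using G by (auto simp: simple_graph_def)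
      then show "card {v\<in>verts G. v \<in> e} = 2" by simp
    qed
  qed (use G in \<open>auto simp: simple_graph_def finite_edges\<close>)
  finally show ?thesis .
qed

text \<open>With \<open>t\<close> common neighbours, \<open>S\<close> would span a copy of the
  forbidden graph. This translates freeness into the hypothesis of the Zarankiewicz bounds.\<close>

lemma card_common_neighbours_less:
  assumes G: "simple_graph G" "graph_free (complete_bipartite s t) G"
    and S: "S \<subseteq> verts G" "card S = s" "0 < s"
    and B: "B \<subseteq> verts G"
  shows "card {b\<in>B. S \<subseteq> neighbours G b} < t"
proof (rule ccontr)
  assume "\<not> ?thesis"
  then have "t \<le> card {b\<in>B. S \<subseteq> neighbours G b}" by simp
  then obtain T where T: "T \<subseteq> {b\<in>B. S \<subseteq> neighbours G b}" "card T = t" "finite T"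
    by (rule obtain_subset_with_card_n)
  have adj: "{x, y} \<in> edges G" if "x \<in> S" "y \<in> T" for x y
    using T that by (auto simp: neighbours_def)
  \<comment> \<open>A common vertex would be adjacent to itself, but a loop has only one element and
    is no edge.\<close>
  have disj: "S \<inter> T = {}"
  proof (rule ccontr)
    assume "S \<inter> T \<noteq> {}"
    then obtain x where "{x, x} \<in> edges G" using adj by blast
    then have "card {x, x} = 2" using G(1) unfolding simple_graph_def by blast
    then show False by simp
  qed
  have finS: "finite S" using S by (simp add: card_ge_0_finite)
  obtain g where g: "bij_betw g S {..<s}"
    using ex_bij_betw_finite_nat[OF finS] S(2) by (auto simp: lessThan_atLeast0)
  obtain h where h: "bij_betw h T {..<t}"
    using ex_bij_betw_finite_nat[OF T(3)] T(2) by (auto simp: lessThan_atLeast0)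
  define f where "f = (\<lambda>x. if x \<in> S then Inl (g x) else Inr (h x))"
  \<comment> \<open>Only the edges between \<open>S\<close> and \<open>T\<close> are kept:
    \<open>graph_isomorphic\<close> demands an equivalence, so edges of \<open>G\<close> inside
    \<open>S\<close> or inside \<open>T\<close> must be dropped.\<close>
  define H where "H = (S \<union> T, {{x, y} | x y. x \<in> S \<and> y \<in> T})"
  have fS: "f x = Inl (g x)" "g x < s" if "x \<in> S" for x
    using that g by (auto simp: f_def bij_betw_def)
  have fT: "f x = Inr (h x)" "h x < t" if "x \<in> T" for x
    using that h disj by (auto simp: f_def bij_betw_def)
  have "subgraph H G"
    unfolding subgraph_def
  proof (intro conjI)
    show "simple_graph H"
      using finS T(3) disj by (auto simp: simple_graph_def H_def card_insert_if)
    show "verts H \<subseteq> verts G" using S T B by (auto simp: H_def)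
    show "edges H \<subseteq> edges G" using adj by (auto simp: H_def)
  qed
  moreover have "graph_isomorphic H (complete_bipartite s t)"
    unfolding graph_isomorphic_def
  proof (intro exI conjI ballI)
    have "bij_betw f S (Inl ` {..<s})"
      using bij_betw_trans[OF g, of Inl "Inl ` {..<s}"]
      by (rule bij_betw_cong[THEN iffD1, rotated]) (auto simp: fS bij_betw_def)
    moreover have "bij_betw f T (Inr ` {..<t})"
      using bij_betw_trans[OF h, of Inr "Inr ` {..<t}"]
      by (rule bij_betw_cong[THEN iffD1, rotated]) (auto simp: fT bij_betw_def)
    ultimately show "bij_betw f (verts H) (verts (complete_bipartite s t))"
      by (auto simp: H_def complete_bipartite_def Plus_def intro!: bij_betw_combine)
  next
    fix u v assume "u \<in> verts H" "v \<in> verts H"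
    then have uv: "u \<in> S \<or> u \<in> T" "v \<in> S \<or> v \<in> T" by (auto simp: H_def)
    have 1: "{u, v} \<in> edges H \<longleftrightarrow> u \<in> S \<and> v \<in> T \<or> v \<in> S \<and> u \<in> T"
      by (auto simp: H_def doubleton_eq_iff)
    have 2: "{f u, f v} \<in> edges (complete_bipartite s t)
        \<longleftrightarrow> u \<in> S \<and> v \<in> T \<or> v \<in> S \<and> u \<in> T"
      using uv disj by (auto simp: complete_bipartite_def doubleton_eq_iff fS fT)
    show "{u, v} \<in> edges H \<longleftrightarrow> {f u, f v} \<in> edges (complete_bipartite s t)"
      using 1 2 by simp
  qed
  ultimately show False using G(2) unfolding graph_free_def by blast
qed

section \<open>Summation over the colour classes\<close>

text \<open>Jensen's inequality with weights \<open>a j / n\<close>, proved by a tangent line.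
  Equality holds when every \<open>a j\<close> is \<open>n / k\<close>, so the constant is the
  balanced one.\<close>

lemma sum_mult_powr_le:
  fixes a :: "nat \<Rightarrow> real"
  assumes a: "\<And>j. j < k \<Longrightarrow> 0 \<le> a j" "(\<Sum>j<k. a j) = n" and p: "0 \<le> p" "p \<le> 1" and k: "k > 1"
  shows "(\<Sum>j<k. a j * (n - a j) powr p) \<le> (1 - 1 / real k) powr p * n powr (1 + p)"
proof (cases "n > 0")
  case True
  define q where "q = 1 - 1 / real k"
  have q: "q > 0" using k by (simp add: q_def)
  have le: "a j \<le> n" if "j < k" for j
    unfolding a(2)[symmetric] using a(1) that by (intro member_le_sum) auto
  \<comment> \<open>The tangent of u^p at u = q n, the complement size of a balanced class. It is
    weighted AM-GM for u / (q n) and 1. At u = 0 the left side is 0, since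
    \<open>0 powr p = 0\<close>.\<close>
  have tangent: "u powr p \<le> (q * n) powr p * ((1 - p) + p * u / (q * n))" if "u \<ge> 0" for u
  proof (cases "u = 0")
    case False
    have "(u / (q * n)) powr p * 1 powr (1 - p) \<le> p * (u / (q * n)) + (1 - p) * 1"
      using q True p False that by (intro Youngs_inequality_0) auto
    then have "(q * n) powr p * (u / (q * n)) powr p \<le> (q * n) powr p * ((1 - p) + p * u / (q * n))"
      by (intro mult_left_mono) auto
    moreover have "(q * n) powr p * (u / (q * n)) powr p = u powr p"
      using q True that by (simp flip: powr_mult)
    ultimately show ?thesis by simp
  qed (use p in simp)
  have "(\<Sum>j<k. a j * (n - a j) powr p)
      \<le> (\<Sum>j<k. a j * ((q * n) powr p * ((1 - p) + p * (n - a j) / (q * n))))"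
    using a le by (intro sum_mono mult_left_mono tangent) auto
  also have "\<dots> = (q * n) powr p * ((1 - p) * (\<Sum>j<k. a j) + p / (q * n) * (\<Sum>j<k. a j * (n - a j)))"
    unfolding sum_distrib_left sum.distrib[symmetric]
    by (intro sum.cong refl) (simp add: add_divide_distrib diff_divide_distrib algebra_simps)
  also have "\<dots> \<le> (q * n) powr p * ((1 - p) * n + p / (q * n) * (q * n\<^sup>2))"
  proof (intro mult_left_mono add_mono)
    \<comment> \<open>Cauchy-Schwarz bounds the sum of squares below by n^2 / k, which is where 1 -
      1/k comes from.\<close>
    have "n\<^sup>2 \<le> (\<Sum>j<k. (a j)\<^sup>2) * k"
      using sum_squared_le_sum_of_squares[of a "{..<k}"] a(2) by simp
    then have "n\<^sup>2 / k \<le> (\<Sum>j<k. (a j)\<^sup>2)" using k by (simp add: field_simps)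
    moreover have "(\<Sum>j<k. a j * (n - a j)) = n * (\<Sum>j<k. a j) - (\<Sum>j<k. (a j)\<^sup>2)"
      by (simp add: algebra_simps sum_subtractf sum_distrib_left power2_eq_square)
    ultimately show "(\<Sum>j<k. a j * (n - a j)) \<le> q * n\<^sup>2"
      using a(2) by (simp add: q_def algebra_simps power2_eq_square)
  qed (use a(2) p q True in auto)
  also have "\<dots> = (q * n) powr p * n"
    using q True by (simp add: field_simps power2_eq_square)
  also have "\<dots> = q powr p * n powr (1 + p)"
    using q True by (simp add: powr_mult powr_add)
  finally show ?thesis by (simp add: q_def)
next
  case False
  have "n = 0" using False a sum_nonneg[of "{..<k}" a] by auto
  moreover have "a j = 0" if "j < k" for j
    using a \<open>n = 0\<close> that sum_nonneg_eq_0_iff[of "{..<k}" a] by auto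
  ultimately show ?thesis by simp
qed

text \<open>The part common to both forbidden graphs. The hypothesis \<open>bound\<close> concerns
  independent sets \<open>A\<close>; \<open>R\<close> collects its lower order terms and is paid
  once per colour, even for an empty class.\<close>

lemma card_edges_colourable_le:
  fixes p C R :: real
  assumes G: "simple_graph G" "colourable G k" "card (verts G) = n"
    and k: "k > 1" and p: "0 \<le> p" "p \<le> 1" and C: "C \<ge> 0"
    and bound: "\<And>A. A \<subseteq> verts G \<Longrightarrow> (\<And>v. v \<in> A \<Longrightarrow> neighbours G v \<subseteq> verts G - A) \<Longrightarrow>
      real (\<Sum>v\<in>A. card (neighbours G v)) \<le> C * card A * real (n - card A) powr p + R"
  shows "2 * real (card (edges G)) \<le> C * (1 - 1 / real k) powr p * real n powr (1 + p) + k * R"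
proof -
  obtain c :: "'a \<Rightarrow> nat" where c: "c ` verts G \<subseteq> {..<k}" "\<And>u v. {u, v} \<in> edges G \<Longrightarrow> c u \<noteq> c v"
    using G(2) by (auto simp: colourable_def)
  define A where "A = (\<lambda>j. {v\<in>verts G. c v = j})"
  have fin: "finite (verts G)" using G by (simp add: simple_graph_def)
  have classes: "(\<Sum>j<k. \<Sum>v\<in>A j. g v) = (\<Sum>v\<in>verts G. g v)" for g :: "'a \<Rightarrow> nat"
    unfolding A_def using fin c(1) by (intro sum.group) auto
  have cardA: "card (A j) \<le> n" for j
    unfolding G(3)[symmetric] using fin by (intro card_mono) (auto simp: A_def)
  have "2 * real (card (edges G)) = (\<Sum>j<k. real (\<Sum>v\<in>A j. card (neighbours G v)))"
    using sum_card_neighbours[OF G(1)] by (simp flip: classes of_nat_sum)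
  also have "\<dots> \<le> (\<Sum>j<k. C * card (A j) * real (n - card (A j)) powr p + R)"
  proof (intro sum_mono bound)
    show "A j \<subseteq> verts G" for j by (auto simp: A_def)
    show "neighbours G v \<subseteq> verts G - A j" if "v \<in> A j" for v j
      using neighbours_subset[OF G(1), of v] c(2) that by (auto simp: A_def neighbours_def)
  qed
  also have "\<dots> = C * (\<Sum>j<k. card (A j) * (real n - card (A j)) powr p) + k * R"
    using cardA by (simp add: sum.distrib sum_distrib_left mult_ac)
  also have "(\<Sum>j<k. card (A j) * (real n - card (A j)) powr p)
      \<le> (1 - 1 / real k) powr p * real n powr (1 + p)"
  proof (rule sum_mult_powr_le)
    show "(\<Sum>j<k. real (card (A j))) = real n"
      using classes[of "\<lambda>_. 1"] G(3) by (simp flip: of_nat_sum)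
  qed (use p k in auto)
  finally show ?thesis using C by (simp add: mult_left_mono mult.assoc)
qed

text \<open>Counts the edges leaving an independent set from the far side, so that the class
  \<open>A\<close> supplies the linear factor of the Zarankiewicz bounds and its complement the
  power.\<close>

lemma sum_card_neighbours_across:
  assumes G: "simple_graph G" and A: "A \<subseteq> verts G" "\<And>v. v \<in> A \<Longrightarrow> neighbours G v \<subseteq> verts G - A"
  shows "(\<Sum>v\<in>A. card (neighbours G v)) = (\<Sum>b\<in>verts G - A. card (neighbours G b \<inter> A))"
proof -
  have fin: "finite (verts G)" "finite A"
    using G A by (auto simp: simple_graph_def intro: finite_subset)
  have "(\<Sum>v\<in>A. card (neighbours G v)) = (\<Sum>v\<in>A. card {b \<in> verts G - A. {v, b} \<in> edges G})"
    using A(2) by (intro sum.cong refl arg_cong[of _ _ card]) (auto simp: neighbours_def insert_commute)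
  also have "\<dots> = (\<Sum>b\<in>verts G - A. card (neighbours G b \<inter> A))"
    using fin by (intro sum_multicount_gen)
      (auto simp: neighbours_def intro!: arg_cong[of _ _ card])
  finally show ?thesis .
qed

section \<open>Edge bounds for the two forbidden graphs\<close>

lemma card_edges_K2t_free:
  assumes G: "simple_graph G" "colourable G k" "card (verts G) = n"
    and free: "graph_free (complete_bipartite 2 t) G" and k: "k > 1" and t: "t \<ge> 1"
  shows "2 * real (card (edges G))
    \<le> sqrt (real t - 1) * (1 - 1 / real k) powr (1/2) * real n powr (3/2) + real k * real n"
proof -
  have "2 * real (card (edges G))
      \<le> sqrt (real t - 1) * (1 - 1 / real k) powr (1/2) * real n powr (1 + 1/2) + real k * real n"
  \<comment> \<open>Here \<open>R\<close> is \<open>n\<close>, which covers the additive term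
    \<open>card B\<close> of \<open>zarankiewicz_two\<close>.\<close>
  proof (rule card_edges_colourable_le[OF G k])
    fix A assume A: "A \<subseteq> verts G" "\<And>v. v \<in> A \<Longrightarrow> neighbours G v \<subseteq> verts G - A"
    have fin: "finite (verts G)" using G by (simp add: simple_graph_def)
    with A have finA: "finite A" by (auto intro: finite_subset)
    have cardB: "card (verts G - A) = n - card A"
      using A finA G(3) by (simp add: card_Diff_subset)
    have across: "(\<Sum>v\<in>A. card (neighbours G v)) = (\<Sum>b\<in>verts G - A. card (neighbours G b \<inter> A))"
      using A by (intro sum_card_neighbours_across[OF G(1)])
    have "real (\<Sum>b\<in>verts G - A. card (neighbours G b \<inter> A))
        \<le> real (card (verts G - A)) + sqrt (real (t - 1)) * card A * sqrt (card (verts G - A))"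
    proof (rule zarankiewicz_two[OF finA])
      fix S assume S: "S \<subseteq> A" "card S = 2"
      have "card {b \<in> verts G - A. S \<subseteq> neighbours G b} < t"
        using S A by (intro card_common_neighbours_less[OF G(1) free]) auto
      with S show "card {b \<in> verts G - A. S \<subseteq> neighbours G b \<inter> A} \<le> t - 1" by simp
    qed (use fin in auto)
    then show "real (\<Sum>v\<in>A. card (neighbours G v))
        \<le> sqrt (real t - 1) * card A * real (n - card A) powr (1/2) + real n"
      using t unfolding across cardB
      by (simp add: powr_half_sqrt)
  qed (use t in auto)
  then show ?thesis by simp
qed

lemma card_edges_K33_free:
  assumes G: "simple_graph G" "colourable G k" "card (verts G) = n"
    and free: "graph_free (complete_bipartite 3 3) G" and k: "k > 1"
  shows "2 * real (card (edges G)) \<le> (1 - 1 / real k) powr (2/3) * real n powr (5/3)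
    + real k * (real n + 2 * real n powr (4/3))"
proof -
  have "2 * real (card (edges G)) \<le> 1 * (1 - 1 / real k) powr (2/3) * real n powr (1 + 2/3)
      + real k * (real n + 2 * real n powr (4/3))"
  \<comment> \<open>Here \<open>C = 1\<close>, and \<open>R\<close> bounds the two additive terms of
    \<open>zarankiewicz_three\<close> by replacing both side sizes with \<open>n\<close>.\<close>
  proof (rule card_edges_colourable_le[OF G k])
    fix A assume A: "A \<subseteq> verts G" "\<And>v. v \<in> A \<Longrightarrow> neighbours G v \<subseteq> verts G - A"
    have fin: "finite (verts G)" using G by (simp add: simple_graph_def)
    with A have finA: "finite A" by (auto intro: finite_subset)
    have cardB: "card (verts G - A) = n - card A"
      using A finA G(3) by (simp add: card_Diff_subset)
    have across: "(\<Sum>v\<in>A. card (neighbours G v)) = (\<Sum>b\<in>verts G - A. card (neighbours G b \<inter> A))"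
      using A by (intro sum_card_neighbours_across[OF G(1)])
    have "card A \<le> n" using A fin G(3) by (auto intro: card_mono)
    moreover have "real (n - card A) powr (4/3) \<le> real n powr (4/3)" by (intro powr_mono2) auto
    moreover have "real (\<Sum>b\<in>verts G - A. card (neighbours G b \<inter> A))
        \<le> card A * real (card (verts G - A)) powr (2/3) + card A
          + 2 * real (card (verts G - A)) powr (4/3)"
    proof (rule zarankiewicz_three[OF finA])
      fix S assume S: "S \<subseteq> A" "card S = 3"
      have "card {b \<in> verts G - A. S \<subseteq> neighbours G b} < 3"
        using S A by (intro card_common_neighbours_less[OF G(1) free]) auto
      with S show "card {b \<in> verts G - A. S \<subseteq> neighbours G b \<inter> A} \<le> 2" by simp
    qed (use fin in auto)
    ultimately show "real (\<Sum>v\<in>A. card (neighbours G v))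
        \<le> 1 * real (card A) * real (n - card A) powr (2/3) + (real n + 2 * real n powr (4/3))"
      unfolding across cardB by simp
  qed auto
  then show ?thesis by simp
qed

section \<open>Extremal numbers and error terms\<close>

text \<open>The maximum is attained, so a bound for every admissible graph transfers to it; the
  chromatic number is replaced by the existence of a colouring.\<close>

lemma ex_chi_le:
  assumes "1 \<le> k" "1 \<le> s" "1 \<le> t"
    and "\<And>G :: nat graph. simple_graph G \<Longrightarrow> colourable G k \<Longrightarrow> card (verts G) = n \<Longrightarrow>
      graph_free (complete_bipartite s t) G \<Longrightarrow> real (card (edges G)) \<le> x"
  shows "real (ex_chi k n (complete_bipartite s t)) \<le> x"
  using ex_chi_attained[OF assms(1-3), of n] assms(4) chromatic_number_le_iff
  unfolding chi_free_graphs_def by (smt (verit) mem_Collect_eq)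

theorem theorem3:
  fixes k :: nat
  assumes "k \<ge> 3"
  shows "(\<forall>t::nat. t \<ge> 2 \<longrightarrow>
            (\<exists>\<epsilon> :: nat \<Rightarrow> real. \<epsilon> \<longlonglongrightarrow> 0 \<and>
              (\<forall>n. real (ex_chi k n (complete_bipartite 2 t))
                 \<le> ((1 - 1 / real k) powr (1/2) + \<epsilon> n)
                    * (sqrt (real t - 1) / 2) * real n powr (3/2)))) \<and>
         (\<exists>\<epsilon> :: nat \<Rightarrow> real. \<epsilon> \<longlonglongrightarrow> 0 \<and>
            (\<forall>n. real (ex_chi k n (complete_bipartite 3 3))
               \<le> ((1 - 1 / real k) powr (2/3) + \<epsilon> n) * (real n powr (5/3) / 2)))"
proof (intro conjI allI impI)
  fix t :: nat
  assume t: "t \<ge> 2"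
  \<comment> \<open>Chosen so that \<open>\<epsilon> n * c * real n powr (3/2)\<close> is exactly
    the error \<open>k * n\<close>. This includes n = 0, where all these powers are 0, so the bound
    holds for every n.\<close>
  define c \<epsilon> where "c = sqrt (real t - 1)" and "\<epsilon> = (\<lambda>n. (k / c) * real n powr (-1/2))"
  have c: "c > 0" using t by (simp add: c_def)
  have "((\<lambda>n. real n powr (-1/2)) \<longlongrightarrow> 0) sequentially" by real_asymp
  then have "\<epsilon> \<longlonglongrightarrow> 0" unfolding \<epsilon>_def by (rule tendsto_mult_right_zero)
  moreover have "real (ex_chi k n (complete_bipartite 2 t))
      \<le> ((1 - 1 / real k) powr (1/2) + \<epsilon> n) * (c / 2) * real n powr (3/2)" for n
  proof (rule ex_chi_le)
    fix G :: "nat graph"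
    assume "simple_graph G" "colourable G k" "card (verts G) = n"
      "graph_free (complete_bipartite 2 t) G"
    then have "2 * real (card (edges G))
        \<le> c * (1 - 1 / real k) powr (1/2) * real n powr (3/2) + real k * real n"
      unfolding c_def using assms t by (intro card_edges_K2t_free) auto
    moreover have "real n powr (-1/2) * real n powr (3/2) = real n"
      by (simp flip: powr_add)
    then have "\<epsilon> n * c * real n powr (3/2) = real k * real n"
      using c by (simp add: \<epsilon>_def)
    ultimately show "real (card (edges G))
        \<le> ((1 - 1 / real k) powr (1/2) + \<epsilon> n) * (c / 2) * real n powr (3/2)"
      by (simp add: algebra_simps)
  qed (use assms t in auto)
  ultimately show "\<exists>\<epsilon> :: nat \<Rightarrow> real. \<epsilon> \<longlonglongrightarrow> 0 \<and>
      (\<forall>n. real (ex_chi k n (complete_bipartite 2 t))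
         \<le> ((1 - 1 / real k) powr (1/2) + \<epsilon> n) * (sqrt (real t - 1) / 2) * real n powr (3/2))"
    unfolding c_def by blast
next
  \<comment> \<open>Each error term of \<open>card_edges_K33_free\<close> divided by
    n^(5/3).\<close>
  define \<epsilon> where "\<epsilon> = (\<lambda>n. k * (real n powr (-2/3) + 2 * real n powr (-1/3)))"
  have "((\<lambda>n. real n powr (-2/3) + 2 * real n powr (-1/3)) \<longlongrightarrow> 0) sequentially" by real_asymp
  then have "\<epsilon> \<longlonglongrightarrow> 0" unfolding \<epsilon>_def by (rule tendsto_mult_right_zero)
  moreover have "real (ex_chi k n (complete_bipartite 3 3))
      \<le> ((1 - 1 / real k) powr (2/3) + \<epsilon> n) * (real n powr (5/3) / 2)" for n
  proof (rule ex_chi_le)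
    fix G :: "nat graph"
    assume "simple_graph G" "colourable G k" "card (verts G) = n"
      "graph_free (complete_bipartite 3 3) G"
    then have "2 * real (card (edges G)) \<le> (1 - 1 / real k) powr (2/3) * real n powr (5/3)
        + real k * (real n + 2 * real n powr (4/3))"
      using assms by (intro card_edges_K33_free) auto
    moreover have "real n powr (-2/3) * real n powr (5/3) = real n"
      "real n powr (-1/3) * real n powr (5/3) = real n powr (4/3)"
      by (simp_all flip: powr_add)
    then have "\<epsilon> n * real n powr (5/3) = real k * (real n + 2 * real n powr (4/3))"
      by (simp add: \<epsilon>_def distrib_right mult.assoc)
    ultimately show "real (card (edges G))
        \<le> ((1 - 1 / real k) powr (2/3) + \<epsilon> n) * (real n powr (5/3) / 2)"
      by (simp add: field_simps)
  qed (use assms in auto)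
  ultimately show "\<exists>\<epsilon> :: nat \<Rightarrow> real. \<epsilon> \<longlonglongrightarrow> 0 \<and>
      (\<forall>n. real (ex_chi k n (complete_bipartite 3 3))
         \<le> ((1 - 1 / real k) powr (2/3) + \<epsilon> n) * (real n powr (5/3) / 2))"
    by blast
qed

end
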